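(* Let $s>5$, and consider the 2d Euler equations on $\mathbb{T}\times[-1,1]$: $$\partial_tU+U\cdot\nabla U+\nabla P=0,\qquad\nabla\cdot U=0,\qquad U_2(x,\pm1)=0.$$ There exists $\varepsilon_0>0$ such that if $U(x-ct,y)$, with $c\in\mathbb{R}$, is any traveling wave solution to these equations that satisfies $$\|\Omega+2y\|_{H^s}\le\varepsilon_0,\qquad\text{where }U=\nabla^\perp\Psi,\quad\Delta\Psi=\Omega,$$ then $U\equiv(U_1,0)$, that is, $U$ is necessarily a shear flow.
   Context: $\mathbb{T}=\mathbb{R}/2\pi\mathbb{Z}$, $(x,y)\in\mathbb{T}\times[-1,1]$, $\nabla^\perp=(-\partial_y,\partial_x)$, $U=(U_1,U_2)$, and $\Omega=\partial_xU_2-\partial_yU_1$ is the vorticity. The Poiseuille flow is $U_P(y)=(y^2,0)$, whose vorticity is $-2y$. A traveling wave solution is a solution of the form $(t,x,y)\mapsto U(x-ct,y)$. *)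

theory Defs
  imports "HOL-Analysis.Analysis"
begin

text \<open>
  Functions on \<open>\<T> \<times> [-1,1]\<close>, with \<open>\<T> = \<real>/2\<pi>\<int>\<close>, are represented by functions on the plane that are
  \<open>2\<pi>\<close>-periodic in the first variable.  Only their values on \<open>strip\<close> matter.
\<close>

definition strip :: "(real \<times> real) set"
  where "strip = UNIV \<times> {-1..1}"

definition x_periodic :: "(real \<times> real \<Rightarrow> 'a) \<Rightarrow> bool"
  where "x_periodic f \<longleftrightarrow> (\<forall>(x, y) \<in> strip. f (x + 2 * pi, y) = f (x, y))"

text \<open>Continuous differentiability on a possibly non-open set, here with derivatives up to the
  boundary.\<close>

definition C1_on :: "'a::real_normed_vector set \<Rightarrow> ('a \<Rightarrow> 'b::real_normed_vector) \<Rightarrow> bool"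
  where "C1_on S f \<longleftrightarrow>
    (\<exists>f'. (\<forall>z\<in>S. (f has_derivative blinfun_apply (f' z)) (at z within S)) \<and> continuous_on S f')"

text \<open>Taking \<open>\<partial>\<^sub>y\<close> within \<open>[-1,1]\<close> makes it the one-sided derivative at the walls and
  independent of the values off the strip.\<close>

definition d_x :: "(real \<times> real \<Rightarrow> 'a::real_normed_vector) \<Rightarrow> real \<times> real \<Rightarrow> 'a"
  where "d_x f = (\<lambda>(x, y). vector_derivative (\<lambda>\<xi>. f (\<xi>, y)) (at x))"

definition d_y :: "(real \<times> real \<Rightarrow> 'a::real_normed_vector) \<Rightarrow> real \<times> real \<Rightarrow> 'a"
  where "d_y f = (\<lambda>(x, y). vector_derivative (\<lambda>\<eta>. f (x, \<eta>)) (at y within {-1..1}))"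

definition grad :: "(real \<times> real \<Rightarrow> real) \<Rightarrow> real \<times> real \<Rightarrow> real \<times> real"
  where "grad f z = (d_x f z, d_y f z)"

definition perp_grad :: "(real \<times> real \<Rightarrow> real) \<Rightarrow> real \<times> real \<Rightarrow> real \<times> real"
  where "perp_grad f z = (- d_y f z, d_x f z)"

definition laplacian :: "(real \<times> real \<Rightarrow> real) \<Rightarrow> real \<times> real \<Rightarrow> real"
  where "laplacian f z = d_x (d_x f) z + d_y (d_y f) z"

definition divergence :: "(real \<times> real \<Rightarrow> real \<times> real) \<Rightarrow> real \<times> real \<Rightarrow> real"
  where "divergence U z = d_x (\<lambda>w. fst (U w)) z + d_y (\<lambda>w. snd (U w)) z"

definition vorticity :: "(real \<times> real \<Rightarrow> real \<times> real) \<Rightarrow> real \<times> real \<Rightarrow> real"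
  where "vorticity U z = d_x (\<lambda>w. snd (U w)) z - d_y (\<lambda>w. fst (U w)) z"

text \<open>\<open>(U \<cdot> \<nabla>) V\<close>\<close>

definition advection ::
    "(real \<times> real \<Rightarrow> real \<times> real) \<Rightarrow> (real \<times> real \<Rightarrow> real \<times> real) \<Rightarrow> real \<times> real \<Rightarrow> real \<times> real"
  where "advection U V z = fst (U z) *\<^sub>R d_x V z + snd (U z) *\<^sub>R d_y V z"

definition euler_solution ::
    "(real \<Rightarrow> real \<times> real \<Rightarrow> real \<times> real) \<Rightarrow> (real \<Rightarrow> real \<times> real \<Rightarrow> real) \<Rightarrow> bool"
  where "euler_solution u p \<longleftrightarrow>
    C1_on (UNIV \<times> strip) (\<lambda>(t, z). u t z) \<and>
    (\<forall>t. x_periodic (u t) \<and> x_periodic (p t) \<and> C1_on strip (p t)) \<and>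
    (\<forall>t. \<forall>z\<in>strip.
       vector_derivative (\<lambda>\<tau>. u \<tau> z) (at t) + advection (u t) (u t) z + grad (p t) z = 0 \<and>
       divergence (u t) z = 0) \<and>
    (\<forall>t x. snd (u t (x, 1)) = 0 \<and> snd (u t (x, -1)) = 0)"

definition traveling_wave_solution :: "real \<Rightarrow> (real \<times> real \<Rightarrow> real \<times> real) \<Rightarrow> bool"
  where "traveling_wave_solution c U \<longleftrightarrow>
    (\<exists>p. euler_solution (\<lambda>t (x, y). U (x - c * t, y)) p)"

definition shear_flow :: "(real \<times> real \<Rightarrow> real \<times> real) \<Rightarrow> bool"
  where "shear_flow U \<longleftrightarrow> (\<exists>V. \<forall>(x, y) \<in> strip. U (x, y) = (V y, 0))"

text \<open>
  \<open>H\<^sup>s(\<T> \<times> [-1,1])\<close> consists of the restrictions of functions in \<open>H\<^sup>s(\<T> \<times> \<real>)\<close>, with the quotient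
  norm, i.e. the infimum of the \<open>H\<^sup>s(\<T> \<times> \<real>)\<close> norms of all extensions.  An extension is given by
  its Fourier transform \<open>F\<close> on the dual group \<open>\<int> \<times> \<real>\<close>, normalised so that the Fourier transform is
  an isometry of \<open>L\<^sup>2\<close>.  The definition is meant for \<open>s > 1\<close>: then a finite weighted
  integral already makes \<open>F\<close> integrable (Cauchy-Schwarz), and the inversion formula describes the
  continuous representative of the extension pointwise.
\<close>

definition freq_measure :: "(int \<times> real) measure"
  where "freq_measure = count_space UNIV \<Otimes>\<^sub>M lborel"

definition fourier_inv :: "(int \<times> real \<Rightarrow> complex) \<Rightarrow> real \<times> real \<Rightarrow> complex"
  where "fourier_inv F = (\<lambda>(x, y).
    (1 / (2 * pi)) *\<^sub>R (\<integral>(k, \<xi>). F (k, \<xi>) * cis (of_int k * x + \<xi> * y) \<partial>freq_measure))"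

definition sobolev_density :: "real \<Rightarrow> (int \<times> real \<Rightarrow> complex) \<Rightarrow> int \<times> real \<Rightarrow> real"
  where "sobolev_density s F =
    (\<lambda>(k, \<xi>). (1 + (of_int k)\<^sup>2 + \<xi>\<^sup>2) powr s * (cmod (F (k, \<xi>)))\<^sup>2)"

text \<open>The value is \<open>\<infinity>\<close> (the infimum of the empty set) if no extension in \<open>H\<^sup>s\<close> exists.\<close>

definition sobolev_norm :: "real \<Rightarrow> (real \<times> real \<Rightarrow> real) \<Rightarrow> ennreal"
  where "sobolev_norm s f =
    Inf {ennreal (sqrt (integral\<^sup>L freq_measure (sobolev_density s F))) | F.
          integrable freq_measure F \<and>
          integrable freq_measure (sobolev_density s F) \<and>
          (\<forall>z\<in>strip. complex_of_real (f z) = fourier_inv F z)}"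

end

theory Submission
  imports Defs "HOL-Probability.Sinc_Integral"
begin

text \<open>
  In the moving frame put \<open>W = U - (c, 0)\<close>.  Since \<open>\<partial>\<^sub>y\<Omega>\<close> is close to \<open>-2\<close>, the steady vorticity
  equation \<open>W \<cdot> \<nabla>\<Omega> = 0\<close> says \<open>W\<^sub>2 = W\<^sub>1 \<phi>\<close> with the regular function
  \<open>\<phi> = - \<partial>\<^sub>x\<Omega> / \<partial>\<^sub>y\<Omega>\<close>, even across critical layers, where \<open>W\<^sub>1 = 0\<close>.  Combined with
  incompressibility, the momentum equation becomes \<open>(-\<partial>\<^sub>yP, \<partial>\<^sub>xP) = W\<^sub>1\<^sup>2 \<nabla>\<phi>\<close>.  Pairing it with \<open>\<nabla>\<phi>\<close>
  gives a divergence, whose boundary terms vanish because \<open>\<phi> \<partial>\<^sub>xP = W\<^sub>2 W\<^sub>1 \<partial>\<^sub>y\<phi> = 0\<close> on the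
  walls; hence \<open>W\<^sub>1\<^sup>2 |\<nabla>\<phi>|\<^sup>2 = 0\<close>.  As \<open>W\<close> cannot vanish on an open set, where \<open>\<Omega>\<close> would be
  constant, \<open>\<nabla>\<phi> = 0\<close>.  By periodicity \<open>\<partial>\<^sub>x\<Omega>\<close> has a zero on every horizontal line, so
  \<open>\<phi> = 0\<close> and \<open>W\<^sub>2 = 0\<close>.  The \<open>H\<^sup>s\<close> norm only serves to make \<open>\<Omega>\<close> three times continuously
  differentiable with \<open>|\<partial>\<^sub>y\<Omega> + 2| < 2\<close>.
\<close>

subsection \<open>Calculus on the strip\<close>

lemma mem_strip [simp]: "(x, y) \<in> strip \<longleftrightarrow> -1 \<le> y \<and> y \<le> 1"
  by (auto simp: strip_def)

text \<open>The partials are carried as explicit functions, so that a product or a quotient comes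
  with a formula for its derivatives. Continuity up to the walls is built in, with a one-sided
  \<open>y\<close>-derivative there.\<close>

definition has_strip_partials ::
    "(real \<times> real \<Rightarrow> real) \<Rightarrow> (real \<times> real \<Rightarrow> real) \<Rightarrow> (real \<times> real \<Rightarrow> real) \<Rightarrow> bool"
  where "has_strip_partials f fx fy \<longleftrightarrow>
    continuous_on strip f \<and> continuous_on strip fx \<and> continuous_on strip fy \<and>
    (\<forall>x. \<forall>y\<in>{-1..1}. ((\<lambda>\<xi>. f (\<xi>, y)) has_real_derivative fx (x, y)) (at x) \<and>
      ((\<lambda>\<eta>. f (x, \<eta>)) has_real_derivative fy (x, y)) (at y within {-1..1}))"

section \<open>Algebra of functions that are C1 up to the walls\<close>

lemma has_strip_partials_cong:
  assumes "has_strip_partials f fx fy"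
    and "\<And>z. z \<in> strip \<Longrightarrow> g z = f z" "\<And>z. z \<in> strip \<Longrightarrow> gx z = fx z" "\<And>z. z \<in> strip \<Longrightarrow> gy z = fy z"
  shows "has_strip_partials g gx gy"
proof -
  have S: "(x, y) \<in> strip \<longleftrightarrow> y \<in> {-1..1}" for x y
    by (auto simp: strip_def)
  have 1: "continuous_on strip g" "continuous_on strip gx" "continuous_on strip gy"
    using assms continuous_on_cong[of strip strip] unfolding has_strip_partials_def by blast+
  have 2: "((\<lambda>\<xi>. g (\<xi>, y)) has_real_derivative gx (x, y)) (at x)" if "y \<in> {-1..1}" for x y
  proof -
    have "(\<lambda>\<xi>. g (\<xi>, y)) = (\<lambda>\<xi>. f (\<xi>, y))" "gx (x, y) = fx (x, y)"
      using that assms(2,3) S by auto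
    then show ?thesis using assms(1) that unfolding has_strip_partials_def by simp
  qed
  have 3: "((\<lambda>\<eta>. g (x, \<eta>)) has_real_derivative gy (x, y)) (at y within {-1..1})"
    if "y \<in> {-1..1}" for x y
  proof -
    have "((\<lambda>\<eta>. f (x, \<eta>)) has_real_derivative gy (x, y)) (at y within {-1..1})"
      using assms(1,4) that S unfolding has_strip_partials_def by simp
    then show ?thesis
      by (rule has_field_derivative_transform_within[of _ _ _ _ 1]) (use that assms(2) S in auto)
  qed
  show ?thesis unfolding has_strip_partials_def using 1 2 3 by blast
qed

lemma has_strip_partials_const: "has_strip_partials (\<lambda>_. c) (\<lambda>_. 0) (\<lambda>_. 0)"
  unfolding has_strip_partials_def by (auto intro!: derivative_eq_intros)

lemma has_strip_partials_snd: "has_strip_partials snd (\<lambda>_. 0) (\<lambda>_. 1)"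
  unfolding has_strip_partials_def by (auto intro!: derivative_eq_intros continuous_intros)

lemma has_strip_partials_add:
  assumes "has_strip_partials f fx fy" "has_strip_partials g gx gy"
  shows "has_strip_partials (\<lambda>z. f z + g z) (\<lambda>z. fx z + gx z) (\<lambda>z. fy z + gy z)"
  using assms unfolding has_strip_partials_def
  by (auto intro!: continuous_intros DERIV_add)

lemma has_strip_partials_mult:
  assumes "has_strip_partials f fx fy" "has_strip_partials g gx gy"
  shows "has_strip_partials (\<lambda>z. f z * g z) (\<lambda>z. fx z * g z + f z * gx z) (\<lambda>z. fy z * g z + f z * gy z)"
  using assms unfolding has_strip_partials_def
  by (auto intro!: continuous_intros derivative_eq_intros simp: algebra_simps)

lemma has_strip_partials_minus:
  assumes "has_strip_partials f fx fy"
  shows "has_strip_partials (\<lambda>z. - f z) (\<lambda>z. - fx z) (\<lambda>z. - fy z)"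
  using assms unfolding has_strip_partials_def
  by (auto intro!: continuous_intros derivative_eq_intros)

lemma has_strip_partials_inverse:
  assumes "has_strip_partials f fx fy" and "\<And>z. z \<in> strip \<Longrightarrow> f z \<noteq> 0"
  shows "has_strip_partials (\<lambda>z. 1 / f z) (\<lambda>z. - fx z * (1 / f z) * (1 / f z)) (\<lambda>z. - fy z * (1 / f z) * (1 / f z))"
proof -
  have nz: "f (x, y) \<noteq> 0" if "y \<in> {-1..1}" for x y
    using assms(2)[of "(x, y)"] that by (auto simp: strip_def)
  show ?thesis
    using assms(1,2) nz unfolding has_strip_partials_def
    by (auto intro!: continuous_intros derivative_eq_intros simp: divide_simps)
qed

text \<open>For the highest derivatives, where only existence matters and the formulas would be
  long.\<close>

definition C1_strip :: "(real \<times> real \<Rightarrow> real) \<Rightarrow> bool"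
  where "C1_strip f \<longleftrightarrow> (\<exists>fx fy. has_strip_partials f fx fy)"

lemma C1_strip_minus: "C1_strip f \<Longrightarrow> C1_strip (\<lambda>z. - f z)"
  unfolding C1_strip_def using has_strip_partials_minus by blast

lemma C1_strip_add: "C1_strip f \<Longrightarrow> C1_strip g \<Longrightarrow> C1_strip (\<lambda>z. f z + g z)"
  unfolding C1_strip_def using has_strip_partials_add by blast

lemma C1_strip_mult: "C1_strip f \<Longrightarrow> C1_strip g \<Longrightarrow> C1_strip (\<lambda>z. f z * g z)"
  unfolding C1_strip_def using has_strip_partials_mult by blast

lemma C1_strip_inverse:
  "C1_strip f \<Longrightarrow> (\<And>z. z \<in> strip \<Longrightarrow> f z \<noteq> 0) \<Longrightarrow> C1_strip (\<lambda>z. 1 / f z)"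
  unfolding C1_strip_def using has_strip_partials_inverse by blast

section \<open>Uniqueness, symmetry and periodicity of partials\<close>

lemma has_strip_partialsD:
  assumes "has_strip_partials f fx fy"
  shows "continuous_on strip f" "continuous_on strip fx" "continuous_on strip fy"
    and "-1 \<le> y \<Longrightarrow> y \<le> 1 \<Longrightarrow> ((\<lambda>\<xi>. f (\<xi>, y)) has_real_derivative fx (x, y)) (at x)"
    and "-1 \<le> y \<Longrightarrow> y \<le> 1 \<Longrightarrow> ((\<lambda>\<eta>. f (x, \<eta>)) has_real_derivative fy (x, y)) (at y within {-1..1})"
  using assms by (auto simp: has_strip_partials_def)

lemma DERIV_within_interval_unique:
  fixes f :: "real \<Rightarrow> real"
  assumes "(f has_real_derivative D) (at y within {-1..1})"
    and "(f has_real_derivative E) (at y within {-1..1})" and "y \<in> {-1..1}"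
  shows "D = E"
proof -
  have "at y within {-1..1} \<noteq> bot"
    using assms(3) by (simp add: trivial_limit_within)
  then show ?thesis
    using assms(1,2) unfolding has_field_derivative_iff by (rule tendsto_unique)
qed

lemma integral_d_y:
  assumes f: "has_strip_partials f fx fy" and y: "-1 \<le> y" "y \<le> 1"
  shows "integral {-1..y} (\<lambda>t. fy (x, t)) = f (x, y) - f (x, -1)"
  using y
  by (intro integral_unique fundamental_theorem_of_calculus)
     (auto simp: has_real_derivative_iff_has_vector_derivative[symmetric]
       intro!: has_strip_partialsD(5)[OF f, THEN DERIV_subset])

lemma integral_d_x:
  assumes f: "has_strip_partials f fx fy" and y: "-1 \<le> y" "y \<le> 1" and "a \<le> b"
  shows "integral {a..b} (\<lambda>t. fx (t, y)) = f (b, y) - f (a, y)"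
  using y \<open>a \<le> b\<close>
  by (intro integral_unique fundamental_theorem_of_calculus)
     (auto simp: has_real_derivative_iff_has_vector_derivative[symmetric]
       intro!: has_strip_partialsD(4)[OF f, THEN has_field_derivative_at_within])

text \<open>Clairaut's theorem up to the walls. Write \<open>H (x, t) - H (x, -1)\<close> as the
  integral of \<open>B\<close> over \<open>{-1..t}\<close>. Differentiating under the integral in
  \<open>x\<close> expresses \<open>A (x, t) - A (x, -1)\<close> through \<open>Bx\<close>, and a
  one-sided derivative in \<open>t\<close> then gives \<open>Ay = Bx\<close>.\<close>

lemma mixed_partials_eq:
  assumes H: "has_strip_partials H A B" and A: "has_strip_partials A Ax Ay"
    and B: "has_strip_partials B Bx By" and y: "-1 \<le> y" "y \<le> 1"
  shows "Ay (x, y) = Bx (x, y)"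
proof -
  have contBx: "continuous_on (S \<times> {-1..t}) (\<lambda>(x, y). Bx (x, y))" if "t \<le> 1" for t and S :: "real set"
    using that by (auto intro!: continuous_on_subset[OF has_strip_partialsD(2)[OF B]])
  have contB: "continuous_on {-1..t} (\<lambda>y. B (x, y))" if "t \<le> 1" for t x
    by (rule continuous_on_compose2[OF has_strip_partialsD(1)[OF B]])
       (use that in \<open>auto intro!: continuous_intros\<close>)
  have contBxy: "continuous_on {-1..1} (\<lambda>y. Bx (x, y))" for x
    by (rule continuous_on_compose2[OF has_strip_partialsD(2)[OF B]])
       (auto intro!: continuous_intros)
  have AI: "A (x, t) - A (x, -1) = integral {-1..t} (\<lambda>s. Bx (x, s))" if t: "-1 \<le> t" "t \<le> 1" for t
  proof -
    have "((\<lambda>x. integral (cbox (-1) t) (\<lambda>s. B (x, s))) has_real_derivative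
        integral (cbox (-1) t) (\<lambda>s. Bx (x, s))) (at x within UNIV)"
      by (rule leibniz_rule_field_derivative)
         (use t contBx[of t UNIV] contB in \<open>auto intro!: has_strip_partialsD(4)[OF B] integrable_continuous_real\<close>)
    then have "((\<lambda>x. H (x, t) - H (x, -1)) has_real_derivative
        integral {-1..t} (\<lambda>s. Bx (x, s))) (at x)"
      using integral_d_y[OF H t] by simp
    moreover have "((\<lambda>x. H (x, t) - H (x, -1)) has_real_derivative A (x, t) - A (x, -1)) (at x)"
      using t by (intro DERIV_diff has_strip_partialsD(4)[OF H]) auto
    ultimately show ?thesis by (rule DERIV_unique[rotated])
  qed
  have "((\<lambda>t. integral {-1..t} (\<lambda>s. Bx (x, s))) has_real_derivative Bx (x, y)) (at y within {-1..1})"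
    using y by (intro integral_has_real_derivative contBxy) auto
  then have "((\<lambda>t. A (x, t) - A (x, -1)) has_real_derivative Bx (x, y)) (at y within {-1..1})"
    by (rule has_field_derivative_transform_within[of _ _ _ _ 1]) (use y AI in auto)
  moreover have "((\<lambda>t. A (x, t) - A (x, -1)) has_real_derivative Ay (x, y)) (at y within {-1..1})"
    using has_strip_partialsD(5)[OF A y] by (auto intro!: derivative_eq_intros)
  ultimately show ?thesis
    using y by (intro DERIV_within_interval_unique[of "\<lambda>t. A (x, t) - A (x, -1)"]) auto
qed

lemma has_strip_partials_unique:
  assumes f: "has_strip_partials f fx fy" and g: "has_strip_partials g gx gy"
    and "\<And>z. z \<in> strip \<Longrightarrow> f z = g z" and "z \<in> strip"
  shows "fx z = gx z" "fy z = gy z"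
proof -
  obtain x y where z: "z = (x, y)" by (cases z)
  have g': "has_strip_partials f gx gy"
    by (rule has_strip_partials_cong[OF g]) (use assms(3) in auto)
  show "fx z = gx z"
    using DERIV_unique[OF has_strip_partialsD(4)[OF f] has_strip_partialsD(4)[OF g']] assms(4)
    by (auto simp: z)
  show "fy z = gy z"
    using DERIV_within_interval_unique[OF has_strip_partialsD(5)[OF f] has_strip_partialsD(5)[OF g']] assms(4)
    by (auto simp: z)
qed

text \<open>The translate of \<open>f\<close> by \<open>p\<close> has the translated partials and
  coincides with \<open>f\<close>, so uniqueness of partials applies.\<close>

lemma has_strip_partials_periodic:
  assumes f: "has_strip_partials f fx fy" and per: "\<And>x y. (x, y) \<in> strip \<Longrightarrow> f (x + p, y) = f (x, y)"
    and z: "(x, y) \<in> strip"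
  shows "fx (x + p, y) = fx (x, y)" "fy (x + p, y) = fy (x, y)"
proof -
  have c: "continuous_on strip (\<lambda>z. g (fst z + p, snd z))" if "continuous_on strip g" for g :: "real \<times> real \<Rightarrow> real"
    by (rule continuous_on_compose2[OF that]) (auto intro!: continuous_intros simp: strip_def)
  have "((\<lambda>\<xi>. f (\<xi> + p, y)) has_real_derivative fx (x + p, y)) (at x)" if "-1 \<le> y" "y \<le> 1" for x y
    using has_strip_partialsD(4)[OF f that, of "x + p"] DERIV_shift[of "\<lambda>\<xi>. f (\<xi>, y)"] by simp
  then have "has_strip_partials (\<lambda>z. f (fst z + p, snd z)) (\<lambda>z. fx (fst z + p, snd z)) (\<lambda>z. fy (fst z + p, snd z))"
    using has_strip_partialsD[OF f] c unfolding has_strip_partials_def by auto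
  from has_strip_partials_unique[OF this f _ z] per
  show "fx (x + p, y) = fx (x, y)" "fy (x + p, y) = fy (x, y)"
    by (auto simp: strip_def)
qed

text \<open>Near \<open>z\<close> the restrictions of \<open>f\<close> to both coordinate lines
  agree with zero. The neighbourhood is relative to the strip, so \<open>z\<close> may lie on a
  wall.\<close>

lemma has_strip_partials_locally_zero:
  assumes f: "has_strip_partials f fx fy"
    and 0: "\<And>z. z \<in> strip \<Longrightarrow> dist z z0 < \<delta> \<Longrightarrow> f z = 0"
    and z: "z \<in> strip" "dist z z0 < \<delta>"
  shows "fx z = 0" "fy z = 0"
proof -
  obtain x y where xy: "z = (x, y)" by (cases z)
  define r where "r = \<delta> - dist z z0"
  have r: "r > 0" using z by (simp add: r_def)
  have near: "f w = 0" if "w \<in> strip" "dist w z < r" for w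
    using that dist_triangle[of w z0 z] by (intro 0) (auto simp: r_def)
  have y: "-1 \<le> y" "y \<le> 1" using z by (auto simp: xy)
  have "((\<lambda>\<xi>. 0) has_real_derivative fx z) (at x)"
    using has_strip_partialsD(4)[OF f y, of x] unfolding xy
    by (rule has_field_derivative_transform_within[of _ _ _ _ r])
       (use r y near in \<open>auto simp: xy dist_Pair_Pair\<close>)
  then show "fx z = 0" using DERIV_unique DERIV_const by blast
  have "((\<lambda>\<eta>. 0) has_real_derivative fy z) (at y within {-1..1})"
    using has_strip_partialsD(5)[OF f y, of x] unfolding xy
    by (rule has_field_derivative_transform_within[of _ _ _ _ r])
       (use r y near in \<open>auto simp: xy dist_Pair_Pair\<close>)
  then show "fy z = 0" using DERIV_within_interval_unique[OF _ DERIV_const] y by auto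
qed

text \<open>The Jacobian of \<open>(P, \<phi>)\<close> equals the divergence expression d_x (P
  \<phi>_y) - d_y (P \<phi>_x), in which the second derivatives fall on \<open>\<phi>\<close>
  because \<open>P\<close> is only C1. The first term integrates to zero by periodicity. The second
  leaves P \<phi>_x on the walls, where an integration by parts along the wall turns it into -Px
  \<phi> = 0.\<close>

lemma integral_null_lagrangian:
  assumes P: "has_strip_partials P Px Py" and \<phi>: "has_strip_partials \<phi> \<phi>x \<phi>y"
    and "C1_strip \<phi>x" "C1_strip \<phi>y"
    and perP: "\<And>x y. (x, y) \<in> strip \<Longrightarrow> P (x + p, y) = P (x, y)"
    and per\<phi>: "\<And>x y. (x, y) \<in> strip \<Longrightarrow> \<phi> (x + p, y) = \<phi> (x, y)"
    and wall: "\<And>x. Px (x, 1) * \<phi> (x, 1) = 0" "\<And>x. Px (x, -1) * \<phi> (x, -1) = 0"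
    and p: "p > 0"
  shows "integral {a..a + p} (\<lambda>x. integral {-1..1} (\<lambda>y. Px (x, y) * \<phi>y (x, y) - Py (x, y) * \<phi>x (x, y))) = 0"
proof -
  obtain \<phi>xx \<phi>xy \<phi>yx \<phi>yy where \<phi>x: "has_strip_partials \<phi>x \<phi>xx \<phi>xy"
    and \<phi>y: "has_strip_partials \<phi>y \<phi>yx \<phi>yy"
    using assms(3,4) unfolding C1_strip_def by blast
  have clairaut: "\<phi>xy (x, y) = \<phi>yx (x, y)" if "-1 \<le> y" "y \<le> 1" for x y
    using mixed_partials_eq[OF \<phi> \<phi>x \<phi>y that] .
  \<comment> \<open>\<open>N\<close> and \<open>M\<close> are the two terms of the divergence form;
    their second-order parts agree by \<open>clairaut\<close> and cancel in
    \<open>N - M\<close>.\<close>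
  define N where "N = (\<lambda>z. Px z * \<phi>y z + P z * \<phi>yx z)"
  define M where "M = (\<lambda>z. Py z * \<phi>x z + P z * \<phi>xy z)"
  have N: "has_strip_partials (\<lambda>z. P z * \<phi>y z) N (\<lambda>z. Py z * \<phi>y z + P z * \<phi>yy z)"
    unfolding N_def by (rule has_strip_partials_mult[OF P \<phi>y])
  have M: "has_strip_partials (\<lambda>z. P z * \<phi>x z) (\<lambda>z. Px z * \<phi>x z + P z * \<phi>xx z) M"
    unfolding M_def by (rule has_strip_partials_mult[OF P \<phi>x])
  \<comment> \<open>The primitive for the integration by parts along each wall.\<close>
  have Q: "has_strip_partials (\<lambda>z. P z * \<phi> z) (\<lambda>z. Px z * \<phi> z + P z * \<phi>x z) (\<lambda>z. Py z * \<phi> z + P z * \<phi>y z)"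
    by (rule has_strip_partials_mult[OF P \<phi>])
  note per\<phi>y = has_strip_partials_periodic(2)[OF \<phi> per\<phi>]
  have cont_y: "continuous_on {-1..1} (\<lambda>y. g (x, y))" if "continuous_on strip g" for g :: "real \<times> real \<Rightarrow> real" and x
    by (rule continuous_on_compose2[OF that]) (auto intro!: continuous_intros)
  have cont_x: "continuous_on S (\<lambda>x. g (x, y))" if "continuous_on strip g" "-1 \<le> y" "y \<le> 1"
    for g :: "real \<times> real \<Rightarrow> real" and y S
    by (rule continuous_on_compose2[OF that(1)]) (use that in \<open>auto intro!: continuous_intros\<close>)
  have sub: "cbox (a, -1) (a + p, 1) \<subseteq> strip"
    by (auto simp: cbox_Pair_eq)
  \<comment> \<open>Exchanging the integrals puts the \<open>x\<close>-integration inside, over one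
    full period of a periodic primitive.\<close>
  have N0: "integral {a..a + p} (\<lambda>x. integral {-1..1} (\<lambda>y. N (x, y))) = 0"
  proof -
    have "integral (cbox a (a + p)) (\<lambda>x. integral (cbox (-1) 1) (\<lambda>y. N (x, y))) =
        integral (cbox (-1) 1) (\<lambda>y. integral (cbox a (a + p)) (\<lambda>x. N (x, y)))"
      by (rule integral_swap_continuous)
         (use continuous_on_subset[OF has_strip_partialsD(2)[OF N] sub] in simp)
    also have "\<dots> = integral {-1..1} (\<lambda>y. integral {a..a + p} (\<lambda>x. N (x, y)))"
      by simp
    also have "\<dots> = integral {-1..1} (\<lambda>y :: real. 0)"
    proof (rule Henstock_Kurzweil_Integration.integral_cong)
      fix y :: real assume "y \<in> {-1..1}"
      then have "-1 \<le> y" "y \<le> 1" by auto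
      then show "integral {a..a + p} (\<lambda>x. N (x, y)) = 0"
        using integral_d_x[OF N, of y a "a + p"] p perP per\<phi>y by simp
    qed
    finally show ?thesis by simp
  qed
  have M0: "integral {a..a + p} (\<lambda>x. P (x, y) * \<phi>x (x, y)) = 0" if "y = 1 \<or> y = -1" for y
  proof -
    have "integral {a..a + p} (\<lambda>x. P (x, y) * \<phi>x (x, y)) =
        integral {a..a + p} (\<lambda>x. Px (x, y) * \<phi> (x, y) + P (x, y) * \<phi>x (x, y))"
    proof (rule Henstock_Kurzweil_Integration.integral_cong)
      fix x
      have "Px (x, y) * \<phi> (x, y) = 0" using that wall by blast
      then show "P (x, y) * \<phi>x (x, y) = Px (x, y) * \<phi> (x, y) + P (x, y) * \<phi>x (x, y)" by linarith
    qed
    also have "\<dots> = 0"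
      using integral_d_x[OF Q, of y a "a + p"] that p perP per\<phi> by auto
    finally show ?thesis .
  qed
  have "integral {a..a + p} (\<lambda>x. integral {-1..1} (\<lambda>y. Px (x, y) * \<phi>y (x, y) - Py (x, y) * \<phi>x (x, y))) =
      integral {a..a + p} (\<lambda>x. integral {-1..1} (\<lambda>y. N (x, y)) - (P (x, 1) * \<phi>x (x, 1) - P (x, -1) * \<phi>x (x, -1)))"
  proof (intro Henstock_Kurzweil_Integration.integral_cong)
    fix x
    have "integral {-1..1} (\<lambda>y. Px (x, y) * \<phi>y (x, y) - Py (x, y) * \<phi>x (x, y)) =
        integral {-1..1} (\<lambda>y. N (x, y) - M (x, y))"
      by (intro Henstock_Kurzweil_Integration.integral_cong) (use clairaut in \<open>auto simp: N_def M_def\<close>)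
    also have "\<dots> = integral {-1..1} (\<lambda>y. N (x, y)) - integral {-1..1} (\<lambda>y. M (x, y))"
      by (intro Henstock_Kurzweil_Integration.integral_diff integrable_continuous_real cont_y
          has_strip_partialsD(2)[OF N] has_strip_partialsD(3)[OF M])
    also have "integral {-1..1} (\<lambda>y. M (x, y)) = P (x, 1) * \<phi>x (x, 1) - P (x, -1) * \<phi>x (x, -1)"
      using integral_d_y[OF M, of 1 x] by simp
    finally show "integral {-1..1} (\<lambda>y. Px (x, y) * \<phi>y (x, y) - Py (x, y) * \<phi>x (x, y)) =
        integral {-1..1} (\<lambda>y. N (x, y)) - (P (x, 1) * \<phi>x (x, 1) - P (x, -1) * \<phi>x (x, -1))" .
  qed
  also have "\<dots> = 0"
  proof -
    have "continuous_on {a..a + p} (\<lambda>x. integral (cbox (-1) 1) (\<lambda>y. N (x, y)))"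
      by (rule integral_continuous_on_param)
         (auto intro!: continuous_on_subset[OF has_strip_partialsD(2)[OF N]])
    then have 1: "(\<lambda>x. integral {-1..1} (\<lambda>y. N (x, y))) integrable_on {a..a + p}"
      by (auto intro: integrable_continuous_real)
    have 2: "(\<lambda>x. P (x, y) * \<phi>x (x, y)) integrable_on {a..a + p}" if "y = 1 \<or> y = -1" for y
      using that cont_x[OF has_strip_partialsD(1)[OF M], of y]
      by (intro integrable_continuous_real) auto
    show ?thesis
      using 1 2 N0 M0 by (simp add: Henstock_Kurzweil_Integration.integral_diff
          Henstock_Kurzweil_Integration.integrable_diff)
  qed
  finally show ?thesis .
qed

text \<open>The iterated integral is the integral over a nondegenerate closed box, where a
  continuous nonnegative function with integral zero vanishes identically.\<close>

lemma continuous_nonneg_iterated_integral_zero: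
  assumes cont: "continuous_on strip E" and nonneg: "\<And>z. z \<in> strip \<Longrightarrow> E z \<ge> 0"
    and int: "integral {a..b} (\<lambda>x. integral {-1..1} (\<lambda>y. E (x, y))) = (0 :: real)" and "a < b"
    and z: "x \<in> {a..b}" "(x, y) \<in> strip"
  shows "E (x, y) = 0"
proof -
  have sub: "cbox (a, -1) (b, 1) \<subseteq> strip"
    by (auto simp: cbox_Pair_eq)
  have cont': "continuous_on (cbox (a, -1) (b, 1)) E"
    by (rule continuous_on_subset[OF cont sub])
  have "integral (cbox (a, -1) (b, 1)) E = 0"
    using integral_prod_continuous[of a "-1" b 1 E] cont' int by simp
  moreover have "box (a, -1) (b, 1::real) \<noteq> {}"
    using \<open>a < b\<close> by (auto simp: box_ne_empty Basis_prod_def)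
  ultimately have "\<forall>w\<in>cbox (a, -1) (b, 1). E w = 0"
    using integral_cbox_eq_0_iff[OF cont'] nonneg sub by blast
  then show ?thesis using z by (auto simp: cbox_Pair_eq)
qed

subsection \<open>Rigidity of steady flows with monotone vorticity\<close>

text \<open>With the Bernoulli function H = P + |W|^2 / 2 the momentum equation becomes grad H = (W2
  Om, -W1 Om). Clairaut for \<open>H\<close> is then the vorticity equation, obtained without second
  derivatives of the velocity: only products of C1 functions are differentiated.\<close>

lemma steady_euler_vorticity_transport:
  assumes W1: "has_strip_partials W1 W1x W1y" and W2: "has_strip_partials W2 W2x W2y"
    and P: "has_strip_partials P Px Py" and Om: "has_strip_partials Om Ox Oy"
    and mom1: "\<And>z. z \<in> strip \<Longrightarrow> W1 z * W1x z + W2 z * W1y z + Px z = 0"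
    and mom2: "\<And>z. z \<in> strip \<Longrightarrow> W1 z * W2x z + W2 z * W2y z + Py z = 0"
    and div: "\<And>z. z \<in> strip \<Longrightarrow> W1x z + W2y z = 0"
    and vort: "\<And>z. z \<in> strip \<Longrightarrow> Om z = W2x z - W1y z"
    and z: "z \<in> strip"
  shows "W1 z * Ox z + W2 z * Oy z = 0"
proof -
  define H where "H = (\<lambda>z. P z + (W1 z * W1 z + W2 z * W2 z) * (1/2))"
  have "has_strip_partials H
     (\<lambda>z. Px z + (((W1x z * W1 z + W1 z * W1x z) + (W2x z * W2 z + W2 z * W2x z)) * (1/2)
        + (W1 z * W1 z + W2 z * W2 z) * 0))
     (\<lambda>z. Py z + (((W1y z * W1 z + W1 z * W1y z) + (W2y z * W2 z + W2 z * W2y z)) * (1/2)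
        + (W1 z * W1 z + W2 z * W2 z) * 0))"
    unfolding H_def
    by (intro has_strip_partials_add has_strip_partials_mult has_strip_partials_const P W1 W2)
  then have H: "has_strip_partials H (\<lambda>z. W2 z * Om z) (\<lambda>z. - (W1 z * Om z))"
  proof (rule has_strip_partials_cong)
    fix z assume "z \<in> strip"
    then show "W2 z * Om z = Px z + (((W1x z * W1 z + W1 z * W1x z) + (W2x z * W2 z + W2 z * W2x z)) * (1/2)
        + (W1 z * W1 z + W2 z * W2 z) * 0)"
      unfolding vort[OF \<open>z \<in> strip\<close>] using mom1[of z] by (simp add: algebra_simps)
    show "- (W1 z * Om z) = Py z + (((W1y z * W1 z + W1 z * W1y z) + (W2y z * W2 z + W2 z * W2y z)) * (1/2)
        + (W1 z * W1 z + W2 z * W2 z) * 0)"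
      unfolding vort[OF \<open>z \<in> strip\<close>] using mom2[OF \<open>z \<in> strip\<close>] by (simp add: algebra_simps)
  qed auto
  obtain x y where xy: "z = (x, y)" by (cases z)
  \<comment> \<open>Equality of the mixed derivatives of \<open>H\<close>; incompressibility will
    remove the terms where the velocity is differentiated.\<close>
  have "W2y z * Om z + W2 z * Oy z = - (W1x z * Om z + W1 z * Ox z)"
    using mixed_partials_eq[OF H has_strip_partials_mult[OF W2 Om]
        has_strip_partials_minus[OF has_strip_partials_mult[OF W1 Om]], of y x] z
    by (simp add: xy)
  moreover have "W2y z * Om z = - W1x z * Om z"
    using div[OF z] by (simp add: add_eq_0_iff)
  ultimately show ?thesis by simp
qed

text \<open>The regularity of \<open>Om\<close> makes \<open>\<phi>\<close> twice continuously
  differentiable, as \<open>integral_null_lagrangian\<close> requires, although velocity and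
  pressure are only C1.\<close>

lemma steady_euler_monotone_vorticity_shear:
  assumes W1: "has_strip_partials W1 W1x W1y" and W2: "has_strip_partials W2 W2x W2y"
    and P: "has_strip_partials P Px Py" and Om: "has_strip_partials Om Ox Oy"
    and Ox: "has_strip_partials Ox Oxx Oxy" and Oy: "has_strip_partials Oy Oyx Oyy"
    and C3: "C1_strip Oxx" "C1_strip Oxy" "C1_strip Oyx" "C1_strip Oyy"
    and mom1: "\<And>z. z \<in> strip \<Longrightarrow> W1 z * W1x z + W2 z * W1y z + Px z = 0"
    and mom2: "\<And>z. z \<in> strip \<Longrightarrow> W1 z * W2x z + W2 z * W2y z + Py z = 0"
    and div: "\<And>z. z \<in> strip \<Longrightarrow> W1x z + W2y z = 0"
    and vort: "\<And>z. z \<in> strip \<Longrightarrow> Om z = W2x z - W1y z"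
    and wall: "\<And>x. W2 (x, 1) = 0" "\<And>x. W2 (x, -1) = 0"
    and perP: "\<And>x y. (x, y) \<in> strip \<Longrightarrow> P (x + p, y) = P (x, y)"
    and perOm: "\<And>x y. (x, y) \<in> strip \<Longrightarrow> Om (x + p, y) = Om (x, y)"
    and p: "p > 0"
    and nz: "\<And>z. z \<in> strip \<Longrightarrow> Oy z \<noteq> 0"
    and z: "z \<in> strip"
  shows "W2 z = 0"
proof -
  \<comment> \<open>The slope of the level curves of the vorticity. The transport equation says that
    the velocity is tangent to these curves, hence \<open>W2_eq\<close>.\<close>
  define \<phi> where "\<phi> = (\<lambda>z. - Ox z * (1 / Oy z))"
  define \<phi>x where "\<phi>x = (\<lambda>z. - Oxx z * (1 / Oy z) + - Ox z * (- Oyx z * (1 / Oy z) * (1 / Oy z)))"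
  define \<phi>y where "\<phi>y = (\<lambda>z. - Oxy z * (1 / Oy z) + - Ox z * (- Oyy z * (1 / Oy z) * (1 / Oy z)))"
  have \<phi>: "has_strip_partials \<phi> \<phi>x \<phi>y"
    unfolding \<phi>_def \<phi>x_def \<phi>y_def
    by (intro has_strip_partials_mult has_strip_partials_minus has_strip_partials_inverse Ox Oy nz)
  have C1: "C1_strip Ox" "C1_strip Oy"
    using Ox Oy unfolding C1_strip_def by blast+
  have C1\<phi>: "C1_strip \<phi>x" "C1_strip \<phi>y"
    unfolding \<phi>x_def \<phi>y_def
    by (intro C1_strip_add C1_strip_mult C1_strip_minus C1_strip_inverse C1 C3 nz; assumption)+
  have W2_eq: "W2 z = W1 z * \<phi> z" if "z \<in> strip" for z
    using steady_euler_vorticity_transport[OF W1 W2 P Om mom1 mom2 div vort that] nz[OF that]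
    by (simp add: \<phi>_def field_simps add_eq_0_iff)
  note W1\<phi> = has_strip_partials_mult[OF W1 \<phi>]
  have W2x: "W2x z = W1x z * \<phi> z + W1 z * \<phi>x z" and W2y: "W2y z = W1y z * \<phi> z + W1 z * \<phi>y z"
    if "z \<in> strip" for z
    using has_strip_partials_unique[OF W2 W1\<phi> W2_eq that] by auto
  \<comment> \<open>Incompressibility replaces \<open>W1x\<close> by \<open>- W2y\<close>; after
    substituting \<open>W2 = W1 * \<phi>\<close>, the terms with derivatives of \<open>W1\<close>
    cancel. \<open>Py\<close> works the same way.\<close>
  have Px: "Px z = (W1 z)\<^sup>2 * \<phi>y z" if "z \<in> strip" for z
  proof -
    have "Px z = W1 z * W2y z - W1y z * W2 z"
      using mom1[OF that] div[OF that] by (simp add: add_eq_0_iff algebra_simps)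
    then show ?thesis
      using W2y[OF that] W2_eq[OF that] by (simp add: algebra_simps power2_eq_square)
  qed
  have Py: "Py z = - ((W1 z)\<^sup>2 * \<phi>x z)" if "z \<in> strip" for z
  proof -
    have "Py z = - (W1 z * W2x z - W1x z * W2 z)"
      using mom2[OF that] div[OF that] by (simp add: add_eq_0_iff algebra_simps)
    then show ?thesis
      using W2x[OF that] W2_eq[OF that] by (simp add: algebra_simps power2_eq_square)
  qed
  have per\<phi>: "\<phi> (x + p, y) = \<phi> (x, y)" if "(x, y) \<in> strip" for x y
    using has_strip_partials_periodic[OF Om perOm that] by (simp add: \<phi>_def)
  \<comment> \<open>This Jacobian has integral zero over a period, while the formulas for the
    pressure gradient make it a nonnegative density.\<close>
  define E where "E = (\<lambda>z. Px z * \<phi>y z - Py z * \<phi>x z)"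
  have E: "E z = (W1 z)\<^sup>2 * ((\<phi>x z)\<^sup>2 + (\<phi>y z)\<^sup>2)" if "z \<in> strip" for z
    using Px[OF that] Py[OF that] by (simp add: E_def algebra_simps power2_eq_square)
  \<comment> \<open>One of the two factors \<open>W1\<close> in \<open>Px\<close> combines with
    \<open>\<phi>\<close> to give \<open>W2\<close>, which vanishes on the walls.\<close>
  have wall0: "Px (x, y) * \<phi> (x, y) = 0" if "y = 1 \<or> y = -1" for x y
  proof -
    have "(x, y) \<in> strip" using that by auto
    then have "Px (x, y) * \<phi> (x, y) = W1 (x, y) * \<phi>y (x, y) * W2 (x, y)"
      using Px W2_eq by (simp add: power2_eq_square)
    then show ?thesis using wall that by auto
  qed
  have intE: "integral {a..a + p} (\<lambda>x. integral {-1..1} (\<lambda>y. E (x, y))) = 0" for a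
    unfolding E_def
    using wall0 by (intro integral_null_lagrangian[OF P \<phi> C1\<phi> perP per\<phi> _ _ p]) auto
  have contE: "continuous_on strip E"
    unfolding E_def by (intro continuous_intros has_strip_partialsD[OF P] has_strip_partialsD[OF \<phi>])
  have E0: "E z = 0" if "z \<in> strip" for z
    using continuous_nonneg_iterated_integral_zero[OF contE _ intE[of "fst z"], of "fst z" "snd z"] that p E
    by auto
  \<comment> \<open>Otherwise \<open>\<phi>x\<close> is nonzero near \<open>z\<close>, so
    \<open>E = 0\<close> forces the velocity, and hence the vorticity, to vanish near
    \<open>z\<close>, against \<open>nz\<close>.\<close>
  have \<phi>x0: "\<phi>x z = 0" if zS: "z \<in> strip" for z
  proof (rule ccontr)
    assume "\<phi>x z \<noteq> 0"
    then have "\<bar>\<phi>x z\<bar> > 0" by simp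
    then obtain \<delta> where \<delta>: "\<delta> > 0" "\<And>w. w \<in> strip \<Longrightarrow> dist w z < \<delta> \<Longrightarrow> dist (\<phi>x w) (\<phi>x z) < \<bar>\<phi>x z\<bar>"
      using has_strip_partialsD(2)[OF \<phi>, unfolded continuous_on_iff, rule_format, OF zS] by blast
    have W1_0: "W1 w = 0" if "w \<in> strip" "dist w z < \<delta>" for w
    proof -
      have "\<phi>x w \<noteq> 0" using \<delta>(2)[OF that] by (auto simp: dist_real_def)
      then show ?thesis using E0[OF that(1)] E[OF that(1)]
        by (auto simp: sum_power2_eq_zero_iff)
    qed
    have W2_0: "W2 w = 0" if "w \<in> strip" "dist w z < \<delta>" for w
      using W2_eq W1_0 that by simp
    have "Om w = 0" if "w \<in> strip" "dist w z < \<delta>" for w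
      using has_strip_partials_locally_zero[OF W1 W1_0 that] has_strip_partials_locally_zero[OF W2 W2_0 that]
        vort[OF that(1)] by simp
    then have "Oy z = 0"
      using has_strip_partials_locally_zero(2)[OF Om, of z \<delta> z] zS \<delta>(1) by simp
    then show False using nz[OF zS] by simp
  qed
  obtain x y where xy: "z = (x, y)" by (cases z)
  have y: "-1 \<le> y" "y \<le> 1" using z by (auto simp: xy)
  \<comment> \<open>By periodicity the left side is zero, so \<open>Ox\<close> and with it
    \<open>\<phi>\<close> vanish somewhere on the horizontal line through \<open>z\<close>. Since
    \<open>\<phi>\<close> is constant along that line, it vanishes at \<open>z\<close>.\<close>
  obtain \<xi> where \<xi>: "Om (p, y) - Om (0, y) = (p - 0) * Ox (\<xi>, y)"
    using MVT2[of 0 p "\<lambda>\<xi>. Om (\<xi>, y)" "\<lambda>\<xi>. Ox (\<xi>, y)"] has_strip_partialsD(4)[OF Om y] p by auto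
  then have "Ox (\<xi>, y) = 0"
    using perOm[of 0 y] y p by simp
  then have "\<phi> (\<xi>, y) = 0" by (simp add: \<phi>_def)
  moreover have "\<phi> (x, y) = \<phi> (\<xi>, y)"
    using has_strip_partialsD(4)[OF \<phi> y] \<phi>x0 y by (intro DERIV_isconst_all[of "\<lambda>\<xi>. \<phi> (\<xi>, y)"]) auto
  ultimately show ?thesis using W2_eq[OF z] by (simp add: xy)
qed

subsection \<open>Sobolev embedding via the Fourier transform\<close>

lemma isCont_integral_dominated:
  fixes f :: "'b::metric_space \<Rightarrow> 'a \<Rightarrow> real"
  assumes cont: "\<And>w. isCont (\<lambda>t. f t w) t" and bound: "\<And>t w. \<bar>f t w\<bar> \<le> g w"
    and g: "integrable M g" and meas: "\<And>t. f t \<in> borel_measurable M"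
  shows "isCont (\<lambda>t. \<integral>w. f t w \<partial>M) t"
  unfolding continuous_at_sequentially
proof (intro allI impI)
  fix X assume "X \<longlonglongrightarrow> t"
  then have "(\<lambda>n. f (X n) w) \<longlonglongrightarrow> f t w" for w
    using cont isCont_tendsto_compose by blast
  then have "(\<lambda>n. \<integral>w. f (X n) w \<partial>M) \<longlonglongrightarrow> (\<integral>w. f t w \<partial>M)"
    by (intro integral_dominated_convergence[where w=g] meas g) (auto intro: bound)
  then show "((\<lambda>t. \<integral>w. f t w \<partial>M) \<circ> X) \<longlonglongrightarrow> (\<integral>w. f t w \<partial>M)"
    by (simp add: o_def)
qed

lemma DERIV_integral_dominated:
  fixes f f' :: "real \<Rightarrow> 'a \<Rightarrow> real"
  assumes f: "\<And>t. integrable M (f t)"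
    and deriv: "\<And>t w. ((\<lambda>t. f t w) has_real_derivative f' t w) (at t)"
    and bound: "\<And>t w. \<bar>f' t w\<bar> \<le> g w"
    and g: "integrable M g" and meas: "f' t \<in> borel_measurable M"
  shows "((\<lambda>t. \<integral>w. f t w \<partial>M) has_real_derivative (\<integral>w. f' t w \<partial>M)) (at t)"
  unfolding DERIV_def tendsto_at_iff_sequentially
proof (intro allI impI)
  fix X :: "nat \<Rightarrow> real" assume X: "\<forall>i. X i \<in> UNIV - {0}" "X \<longlonglongrightarrow> 0"
  \<comment> \<open>The mean value inequality lets \<open>g\<close> dominate all difference
    quotients, not only the derivatives.\<close>
  have lip: "\<bar>f b w - f a w\<bar> \<le> g w * \<bar>b - a\<bar>" for a b w
    using field_differentiable_bound[of UNIV "\<lambda>t. f t w" "\<lambda>t. f' t w" "g w" b a] deriv bound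
    by auto
  have "(\<lambda>n. \<integral>w. (f (t + X n) w - f t w) / X n \<partial>M) \<longlonglongrightarrow> (\<integral>w. f' t w \<partial>M)"
  proof (rule integral_dominated_convergence[where w=g])
    show "AE w in M. (\<lambda>n. (f (t + X n) w - f t w) / X n) \<longlonglongrightarrow> f' t w"
      using deriv X unfolding DERIV_def tendsto_at_iff_sequentially o_def by auto
    show "AE w in M. norm ((f (t + X n) w - f t w) / X n) \<le> g w" for n
      using lip[of "t + X n" _ t] X(1) by (auto simp: divide_simps)
  qed (use f g meas in auto)
  then show "((\<lambda>h. ((\<integral>w. f (t + h) w \<partial>M) - (\<integral>w. f t w \<partial>M)) / h) \<circ> X) \<longlonglongrightarrow> (\<integral>w. f' t w \<partial>M)"
    by (simp add: o_def f)
qed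

text \<open>\<open>fourier_partial F a b\<close> is the real part of the inverse Fourier transform of \<open>F\<close>, differentiated
  \<open>a\<close> times in \<open>x\<close> and \<open>b\<close> times in \<open>y\<close> under the integral sign.\<close>

definition fourier_integrand :: "(int \<times> real \<Rightarrow> complex) \<Rightarrow> nat \<Rightarrow> nat \<Rightarrow> real \<times> real \<Rightarrow> int \<times> real \<Rightarrow> real"
  where "fourier_integrand F a b z w = Re ((\<i> * of_int (fst w)) ^ a * (\<i> * of_real (snd w)) ^ b * F w *
    cis (of_int (fst w) * fst z + snd w * snd z))"

definition fourier_partial :: "(int \<times> real \<Rightarrow> complex) \<Rightarrow> nat \<Rightarrow> nat \<Rightarrow> real \<times> real \<Rightarrow> real"
  where "fourier_partial F a b z = (1 / (2 * pi)) * (\<integral>w. fourier_integrand F a b z w \<partial>freq_measure)"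

text \<open>The modulus of the integrand before its real part is taken. It does not depend on the
  point \<open>z\<close> and so serves as the dominating function.\<close>

definition fourier_moment :: "(int \<times> real \<Rightarrow> complex) \<Rightarrow> nat \<Rightarrow> nat \<Rightarrow> int \<times> real \<Rightarrow> real"
  where "fourier_moment F a b w = \<bar>of_int (fst w)\<bar> ^ a * \<bar>snd w\<bar> ^ b * cmod (F w)"

section \<open>Differentiating the Fourier representation\<close>

lemma measurable_freq [measurable]:
  "(\<lambda>w. real_of_int (fst w)) \<in> borel_measurable freq_measure"
  "(\<lambda>w. complex_of_int (fst w)) \<in> borel_measurable freq_measure"
  "(\<lambda>w. snd w) \<in> borel_measurable freq_measure"
  "(\<lambda>w. complex_of_real (snd w)) \<in> borel_measurable freq_measure"
  unfolding freq_measure_def by measurable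

lemma measurable_phase [measurable]:
  "(\<lambda>w. cis (real_of_int (fst w) * x + snd w * y)) \<in> borel_measurable freq_measure"
proof -
  have "cis \<in> borel_measurable borel"
    by (intro borel_measurable_continuous_onI continuous_intros)
  moreover have "(\<lambda>w. real_of_int (fst w) * x + snd w * y) \<in> borel_measurable freq_measure"
    by (intro borel_measurable_add borel_measurable_times measurable_freq borel_measurable_const)
  ultimately show ?thesis by (rule measurable_compose[rotated])
qed

lemma measurable_fourier_integrand:
  assumes [measurable]: "F \<in> borel_measurable freq_measure"
  shows "fourier_integrand F a b z \<in> borel_measurable freq_measure"
proof -
  have "(\<lambda>w. (\<i> * of_int (fst w)) ^ a * (\<i> * of_real (snd w)) ^ b * F w *
      cis (of_int (fst w) * fst z + snd w * snd z)) \<in> borel_measurable freq_measure"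
    by (intro borel_measurable_times borel_measurable_power measurable_freq measurable_phase
        borel_measurable_const assms)
  then show ?thesis
    unfolding fourier_integrand_def by (rule measurable_compose[OF _ borel_measurable_Re])
qed

lemma fourier_integrand_bound: "\<bar>fourier_integrand F a b z w\<bar> \<le> fourier_moment F a b w"
proof -
  have "cmod ((\<i> * of_int (fst w)) ^ a * (\<i> * of_real (snd w)) ^ b * F w *
      cis (of_int (fst w) * fst z + snd w * snd z)) = fourier_moment F a b w"
    by (simp add: fourier_moment_def norm_mult norm_power)
  then show ?thesis using abs_Re_le_cmod unfolding fourier_integrand_def by metis
qed

lemma integrable_fourier_integrand:
  assumes "F \<in> borel_measurable freq_measure" and "integrable freq_measure (fourier_moment F a b)"
  shows "integrable freq_measure (fourier_integrand F a b z)"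
  by (rule Bochner_Integration.integrable_bound[OF assms(2) measurable_fourier_integrand[OF assms(1)]])
     (simp only: real_norm_def order_trans[OF fourier_integrand_bound abs_ge_self] AE_I2)

lemma fourier_partial_bound:
  assumes "F \<in> borel_measurable freq_measure" and "integrable freq_measure (fourier_moment F a b)"
  shows "\<bar>fourier_partial F a b z\<bar> \<le> (1 / (2 * pi)) * integral\<^sup>L freq_measure (fourier_moment F a b)"
proof -
  have "\<bar>\<integral>w. fourier_integrand F a b z w \<partial>freq_measure\<bar> \<le> integral\<^sup>L freq_measure (fourier_moment F a b)"
    using integrable_fourier_integrand[OF assms] fourier_integrand_bound assms(2)
    by (intro order_trans[OF integral_abs_bound integral_mono] integrable_abs) auto
  then show ?thesis
    unfolding fourier_partial_def by (simp add: abs_mult divide_right_mono)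
qed

text \<open>A derivative in \<open>x\<close> or \<open>y\<close> multiplies the integrand by
  \<open>\<i>\<close> times the corresponding frequency, and the next moment dominates the result
  uniformly in the point.\<close>

lemma has_strip_partials_fourier_partial:
  assumes F: "F \<in> borel_measurable freq_measure"
    and int: "integrable freq_measure (fourier_moment F a b)"
      "integrable freq_measure (fourier_moment F (Suc a) b)"
      "integrable freq_measure (fourier_moment F a (Suc b))"
  shows "has_strip_partials (fourier_partial F a b) (fourier_partial F (Suc a) b) (fourier_partial F a (Suc b))"
proof -
  have cont: "continuous_on strip (fourier_partial F a b)" if "integrable freq_measure (fourier_moment F a b)" for a b
  proof (intro continuous_at_imp_continuous_on ballI)
    fix z
    have "continuous_on UNIV (\<lambda>z. fourier_integrand F a b z w)" for w
      unfolding fourier_integrand_def by (intro continuous_intros)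
    then have "isCont (\<lambda>z. fourier_integrand F a b z w) z" for w z
      using continuous_on_eq_continuous_at[OF open_UNIV] by blast
    then have "isCont (\<lambda>z. \<integral>w. fourier_integrand F a b z w \<partial>freq_measure) z"
      by (rule isCont_integral_dominated[OF _ fourier_integrand_bound that measurable_fourier_integrand[OF F]])
    then show "isCont (fourier_partial F a b) z"
      unfolding fourier_partial_def by (intro continuous_intros)
  qed
  have Re_cis: "((\<lambda>t. Re (A * cis (c * t + d))) has_real_derivative Re (\<i> * of_real c * A * cis (c * t + d))) (at t)"
    for A :: complex and c d t :: real
    by (auto intro!: derivative_eq_intros simp: algebra_simps)
  have dx: "((\<lambda>\<xi>. fourier_partial F a b (\<xi>, y)) has_real_derivative fourier_partial F (Suc a) b (x, y)) (at x)" for x y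
  proof -
    have "((\<lambda>\<xi>. fourier_integrand F a b (\<xi>, y) w) has_real_derivative fourier_integrand F (Suc a) b (t, y) w) (at t)" for t w
      using Re_cis[of "(\<i> * of_int (fst w)) ^ a * (\<i> * of_real (snd w)) ^ b * F w" "of_int (fst w)" "snd w * y" t]
      by (simp only: fourier_integrand_def fst_conv snd_conv of_real_of_int_eq power_Suc mult.assoc)
    then show ?thesis
      unfolding fourier_partial_def
      by (intro DERIV_cmult DERIV_integral_dominated[OF _ _ fourier_integrand_bound int(2)]
          integrable_fourier_integrand[OF F int(1)] measurable_fourier_integrand[OF F])
  qed
  have dy: "((\<lambda>\<eta>. fourier_partial F a b (x, \<eta>)) has_real_derivative fourier_partial F a (Suc b) (x, y)) (at y)" for x y
  proof -
    have "((\<lambda>\<eta>. fourier_integrand F a b (x, \<eta>) w) has_real_derivative fourier_integrand F a (Suc b) (x, t) w) (at t)" for t w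
      using Re_cis[of "(\<i> * of_int (fst w)) ^ a * (\<i> * of_real (snd w)) ^ b * F w" "snd w" "of_int (fst w) * x" t]
      by (simp only: fourier_integrand_def fst_conv snd_conv power_Suc ac_simps)
    then show ?thesis
      unfolding fourier_partial_def
      by (intro DERIV_cmult DERIV_integral_dominated[OF _ _ fourier_integrand_bound int(3)]
          integrable_fourier_integrand[OF F int(1)] measurable_fourier_integrand[OF F])
  qed
  show ?thesis
    unfolding has_strip_partials_def
    using cont int dx dy has_field_derivative_at_within by blast
qed

lemma fourier_partial_periodic: "fourier_partial F a b (x + 2 * pi, y) = fourier_partial F a b (x, y)"
proof -
  have "cis (of_int k * (x + 2 * pi) + \<xi> * y) = cis (of_int k * x + \<xi> * y)" for k :: int and \<xi>
  proof -
    have "cis (of_int k * (x + 2 * pi) + \<xi> * y) = cis (of_int k * x + \<xi> * y) * cis (2 * pi * of_int k)"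
      by (simp add: cis_mult algebra_simps)
    then show ?thesis using cis_multiple_2pi by simp
  qed
  then show ?thesis
    by (simp only: fourier_partial_def fourier_integrand_def fst_conv snd_conv)
qed

text \<open>Real parts turn the complex inversion formula into a real function; nothing is lost
  where it represents a real \<open>f\<close>.\<close>

lemma Re_fourier_inv:
  assumes "integrable freq_measure F"
  shows "Re (fourier_inv F z) = fourier_partial F 0 0 z"
proof -
  obtain x y where z: "z = (x, y)" by (cases z)
  have "integrable freq_measure (\<lambda>w. F w * cis (of_int (fst w) * x + snd w * y))"
    by (rule Bochner_Integration.integrable_bound[OF assms])
       (use assms in \<open>auto simp: norm_mult intro!: borel_measurable_times measurable_phase\<close>)
  from integral_Re[OF this]
  have "(\<integral>w. Re (F w * cis (of_int (fst w) * x + snd w * y)) \<partial>freq_measure) =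
      Re (\<integral>w. F w * cis (of_int (fst w) * x + snd w * y) \<partial>freq_measure)" .
  moreover have "(\<lambda>(k, \<xi>). F (k, \<xi>) * cis (of_int k * x + \<xi> * y)) =
      (\<lambda>w. F w * cis (of_int (fst w) * x + snd w * y))"
    by auto
  ultimately show ?thesis
    by (simp only: fourier_inv_def fourier_partial_def fourier_integrand_def z
        power_0 mult_1_left fst_conv snd_conv case_prod_conv scaleR_complex.sel)
qed

text \<open>A product weight, integrable factor by factor. With q = 1 + k^2 + \<xi>^2 it is at least
  q^(-2), which is how it enters the moment bound.\<close>

definition freq_majorant :: "int \<times> real \<Rightarrow> real"
  where "freq_majorant w = inverse (1 + (of_int (fst w))\<^sup>2) * inverse (1 + (snd w)\<^sup>2)"

section \<open>Integrability of the weight and bounds for the moments\<close>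

lemma integrable_inverse_1_plus_square_int:
  "integrable (count_space UNIV) (\<lambda>k :: int. inverse (1 + (real_of_int k)\<^sup>2))"
proof -
  have nat: "(\<lambda>n :: nat. inverse (1 + (real n)\<^sup>2)) summable_on UNIV"
  proof (rule norm_summable_imp_summable_on)
    have "summable (\<lambda>n. inverse (real n ^ 2))"
      by (rule inverse_power_summable) simp
    then show "summable (\<lambda>n. norm (inverse (1 + (real n)\<^sup>2)))"
      by (rule summable_comparison_test_ev[rotated])
         (auto intro!: eventually_sequentiallyI[of 1] le_imp_inverse_le simp: add_pos_nonneg)
  qed
  let ?f = "\<lambda>k :: int. inverse (1 + (real_of_int k)\<^sup>2)"
  have "?f summable_on (range int)" "?f summable_on (range (\<lambda>n. - int n))"
    using nat by (auto simp: summable_on_reindex inj_on_def o_def)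
  then have "?f summable_on (range int \<union> range (\<lambda>n. - int n))"
    by (rule summable_on_union)
  moreover have "k \<in> range int \<union> range (\<lambda>n. - int n)" for k
    by (cases k rule: int_cases2) auto
  then have "range int \<union> range (\<lambda>n. - int n) = UNIV"
    by blast
  ultimately have "?f summable_on UNIV" by simp
  then have "(\<lambda>k. norm (?f k)) summable_on UNIV" by simp
  then show ?thesis
    unfolding abs_summable_equivalent by (simp only: Infinite_Set_Sum.abs_summable_on_def)
qed

lemma integrable_freq_majorant: "integrable freq_measure freq_majorant"
proof -
  interpret pair_sigma_finite "count_space (UNIV :: int set)" "lborel :: real measure"
    by (intro pair_sigma_finite.intro sigma_finite_measure_count_space lborel.sigma_finite_measure_axioms)
  have R: "integrable lborel (\<lambda>x :: real. inverse (1 + x\<^sup>2))"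
    using integrable_inverse_1_plus_square by (simp add: set_integrable_def)
  have [measurable]: "freq_majorant \<in> borel_measurable freq_measure"
    unfolding freq_majorant_def by measurable
  have nn: "norm (freq_majorant (k, \<xi>)) = inverse (1 + (of_int k)\<^sup>2) * inverse (1 + \<xi>\<^sup>2)" for k \<xi>
    by (simp add: freq_majorant_def abs_mult)
  show ?thesis
    unfolding freq_measure_def
  proof (rule Fubini_integrable)
    show "freq_majorant \<in> borel_measurable (count_space UNIV \<Otimes>\<^sub>M lborel)"
      using \<open>freq_majorant \<in> borel_measurable freq_measure\<close> by (simp add: freq_measure_def)
    show "integrable (count_space UNIV) (\<lambda>k. \<integral>\<xi>. norm (freq_majorant (k, \<xi>)) \<partial>lborel)"
      unfolding nn using integrable_inverse_1_plus_square_int by simp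
    show "AE k in count_space UNIV. integrable lborel (\<lambda>\<xi>. freq_majorant (k, \<xi>))"
      using R by (simp add: freq_majorant_def)
  qed
qed

text \<open>The arithmetic-geometric inequality in the role of Cauchy-Schwarz. The squared moment is
  at most q^3 |F|^2, as \<open>a + b \<le> 3\<close>, and the majorant costs q^2 more; this is where
  \<open>s \<ge> 5\<close> comes from. The free parameter \<open>l\<close> later balances the two
  terms.\<close>

lemma fourier_moment_bound:
  assumes ab: "a + b \<le> 3" and s: "s \<ge> 5" and l: "l > 0"
  shows "fourier_moment F a b w \<le> (l * sobolev_density s F w + freq_majorant w / l) / 2"
proof -
  define k where "k = \<bar>real_of_int (fst w)\<bar>"
  define \<xi> where "\<xi> = \<bar>snd w\<bar>"
  define r where "r = cmod (F w)"
  define q where "q = 1 + k\<^sup>2 + \<xi>\<^sup>2"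
  define A where "A = q powr s * r\<^sup>2"
  define B where "B = freq_majorant w"
  have q1: "q \<ge> 1" by (simp add: q_def)
  have A: "sobolev_density s F w = A"
    by (simp add: sobolev_density_def split_beta A_def q_def k_def \<xi>_def r_def)
  have B: "B = inverse ((1 + k\<^sup>2) * (1 + \<xi>\<^sup>2))"
    by (simp add: B_def freq_majorant_def k_def \<xi>_def)
  have pos: "A \<ge> 0" "B > 0"
    by (auto simp: A_def B intro!: mult_pos_pos add_pos_nonneg)
  have "(1 + k\<^sup>2) * (1 + \<xi>\<^sup>2) \<le> q ^ 2"
    by (auto simp: q_def power2_eq_square intro!: mult_mono)
  then have qB: "1 \<le> q ^ 2 * B"
    by (simp add: B field_simps add_pos_nonneg)
  have "(k ^ a * \<xi> ^ b)\<^sup>2 = (k\<^sup>2) ^ a * (\<xi>\<^sup>2) ^ b"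
    by (simp add: power_mult_distrib flip: power_mult) (simp add: mult.commute)
  also have "\<dots> \<le> q ^ a * q ^ b"
    by (intro mult_mono power_mono) (auto simp: q_def)
  also have "\<dots> \<le> q ^ 3"
    using ab q1 by (simp flip: power_add add: power_increasing)
  finally have "(k ^ a * \<xi> ^ b * r)\<^sup>2 \<le> q ^ 3 * r\<^sup>2"
    by (simp add: power_mult_distrib mult_right_mono)
  also have "\<dots> \<le> q ^ 3 * r\<^sup>2 * (q ^ 2 * B)"
    using mult_left_mono[OF qB, of "q ^ 3 * r\<^sup>2"] q1 by simp
  also have "\<dots> = q ^ 5 * r\<^sup>2 * B"
    by (simp add: eval_nat_numeral)
  also have "q ^ 5 \<le> q powr s"
    using q1 s powr_mono[of 5 s q] by simp
  then have "q ^ 5 * r\<^sup>2 * B \<le> A * B"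
    unfolding A_def using pos by (intro mult_right_mono) auto
  finally have X: "(k ^ a * \<xi> ^ b * r)\<^sup>2 \<le> A * B" .
  have "k ^ a * \<xi> ^ b * r \<le> (l * A + B / l) / 2"
  proof (rule power2_le_imp_le)
    \<comment> \<open>The difference of the two sides is
      \<open>(l * A - B / l)\<^sup>2\<close>.\<close>
    have "4 * (A * B) \<le> (l * A + B / l)\<^sup>2"
      using sum_squares_ge_zero[of "l * A - B / l" 0] l by (simp add: power2_eq_square algebra_simps)
    then show "(k ^ a * \<xi> ^ b * r)\<^sup>2 \<le> ((l * A + B / l) / 2)\<^sup>2"
      using X by (simp add: power_divide)
  qed (use pos l in auto)
  then show ?thesis
    by (simp add: fourier_moment_def A B_def k_def \<xi>_def r_def)
qed

lemma integrable_fourier_moment: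
  assumes [measurable]: "F \<in> borel_measurable freq_measure"
    and int: "integrable freq_measure (sobolev_density s F)" and "a + b \<le> 3" "s \<ge> 5"
  shows "integrable freq_measure (fourier_moment F a b)"
proof (rule Bochner_Integration.integrable_bound)
  show "integrable freq_measure (\<lambda>w. (1 * sobolev_density s F w + freq_majorant w / 1) / 2)"
    using int integrable_freq_majorant by simp
  show "fourier_moment F a b \<in> borel_measurable freq_measure"
    unfolding fourier_moment_def by measurable
  show "AE w in freq_measure. norm (fourier_moment F a b w) \<le>
      norm ((1 * sobolev_density s F w + freq_majorant w / 1) / 2)"
    using fourier_moment_bound[OF assms(3,4), of 1 F]
    by (intro AE_I2 order_trans[OF _ abs_ge_self[where 'a=real, folded real_norm_def]])
       (simp add: fourier_moment_def)
qed

lemma fourier_partial_small: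
  assumes F: "F \<in> borel_measurable freq_measure"
    and int: "integrable freq_measure (sobolev_density s F)" and "s \<ge> 5" "a + b \<le> 3" "l > 0"
  shows "\<bar>fourier_partial F a b z\<bar> \<le>
    (l * integral\<^sup>L freq_measure (sobolev_density s F) + integral\<^sup>L freq_measure freq_majorant / l) / (4 * pi)"
proof -
  note mom = integrable_fourier_moment[OF F int \<open>a + b \<le> 3\<close> \<open>s \<ge> 5\<close>]
  have "integral\<^sup>L freq_measure (fourier_moment F a b) \<le>
      (\<integral>w. (l * sobolev_density s F w + freq_majorant w / l) / 2 \<partial>freq_measure)"
    using int integrable_freq_majorant assms
    by (intro integral_mono mom fourier_moment_bound) auto
  also have "\<dots> = (l * integral\<^sup>L freq_measure (sobolev_density s F) + integral\<^sup>L freq_measure freq_majorant / l) / 2"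
    using int integrable_freq_majorant by simp
  finally show ?thesis
    using fourier_partial_bound[OF F mom, of z] by (auto simp: field_simps intro: order_trans)
qed

text \<open>Sobolev embedding in the form used below: orders \<open>a + b \<le> 2\<close> together
  with their partials give three continuous derivatives, and smallness of the norm keeps the
  \<open>y\<close>-derivative below 2.\<close>

lemma small_sobolev_norm_fourier_partials:
  fixes s :: real
  assumes "s \<ge> 5"
  obtains \<epsilon> where "\<epsilon> > 0"
    and "\<And>f. sobolev_norm s f \<le> ennreal \<epsilon> \<Longrightarrow> \<exists>F. (\<forall>z\<in>strip. f z = fourier_partial F 0 0 z) \<and>
      (\<forall>a b. a + b \<le> 2 \<longrightarrow>
        has_strip_partials (fourier_partial F a b) (fourier_partial F (Suc a) b) (fourier_partial F a (Suc b))) \<and>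
      (\<forall>z. \<bar>fourier_partial F 0 1 z\<bar> < 2)"
proof
  define M where "M = integral\<^sup>L freq_measure freq_majorant"
  have M: "M \<ge> 0"
    unfolding M_def by (rule integral_nonneg_AE) (simp add: freq_majorant_def)
  \<comment> \<open>The norm is an infimum that need not be attained, so \<open>F\<close> is only
    known to have norm below \<open>2 * \<epsilon>\<close>. Its squared norm \<open>D\<close> is
    then below \<open>1 / (M + 1)\<close>, and \<open>l = M + 1\<close> makes both terms of
    \<open>fourier_partial_small\<close> harmless.\<close>
  define \<epsilon> where "\<epsilon> = 1 / (2 * sqrt (M + 1))"
  show \<epsilon>: "\<epsilon> > 0" using M by (simp add: \<epsilon>_def)
  fix f assume "sobolev_norm s f \<le> ennreal \<epsilon>"
  also have "\<dots> < ennreal (2 * \<epsilon>)" using \<epsilon> by (simp add: ennreal_less_iff)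
  finally obtain F where F: "integrable freq_measure F" "integrable freq_measure (sobolev_density s F)"
    and f: "\<And>z. z \<in> strip \<Longrightarrow> complex_of_real (f z) = fourier_inv F z"
    and small: "ennreal (sqrt (integral\<^sup>L freq_measure (sobolev_density s F))) < ennreal (2 * \<epsilon>)"
    unfolding sobolev_norm_def Inf_less_iff by blast
  have Fm: "F \<in> borel_measurable freq_measure" using F(1) by auto
  let ?g = "fourier_partial F"
  have part: "has_strip_partials (?g a b) (?g (Suc a) b) (?g a (Suc b))" if "a + b \<le> 2" for a b
    using that by (intro has_strip_partials_fourier_partial Fm integrable_fourier_moment[OF Fm F(2) _ \<open>s \<ge> 5\<close>]) auto
  have gy: "\<bar>?g 0 1 z\<bar> < 2" for z
  proof -
    define D where "D = integral\<^sup>L freq_measure (sobolev_density s F)"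
    have "D \<ge> 0"
      unfolding D_def by (rule integral_nonneg_AE) (auto simp: sobolev_density_def)
    then have "sqrt D < 2 * \<epsilon>"
      using small \<epsilon> by (simp add: ennreal_less_iff D_def)
    then have "sqrt D < sqrt (1 / (M + 1))"
      by (simp add: \<epsilon>_def real_sqrt_divide)
    then have "D < 1 / (M + 1)" by simp
    then have "(M + 1) * D < 1" using M by (simp add: field_simps)
    moreover have "M / (M + 1) \<le> 1" using M by simp
    ultimately have "((M + 1) * D + M / (M + 1)) / (4 * pi) < 2 / (4 * pi)"
      by (intro divide_strict_right_mono) auto
    also have "\<dots> < 2" using pi_gt3 by (simp add: field_simps)
    finally show ?thesis
      using fourier_partial_small[OF Fm F(2) \<open>s \<ge> 5\<close>, of 0 1 "M + 1" z] M
      by (simp add: M_def D_def)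
  qed
  have "f z = ?g 0 0 z" if "z \<in> strip" for z
    using Re_fourier_inv[OF F(1), of z] unfolding f[OF that, symmetric] by simp
  then show "\<exists>F. (\<forall>z\<in>strip. f z = fourier_partial F 0 0 z) \<and>
      (\<forall>a b. a + b \<le> 2 \<longrightarrow>
        has_strip_partials (fourier_partial F a b) (fourier_partial F (Suc a) b) (fourier_partial F a (Suc b))) \<and>
      (\<forall>z. \<bar>fourier_partial F 0 1 z\<bar> < 2)"
    using part gy by (intro exI[of _ F]) simp
qed

subsection \<open>Traveling waves as steady flows\<close>

text \<open>Composing with the embeddings of horizontal lines and vertical segments identifies the
  partials with the derivative within the strip applied to (1, 0) and (0, 1). Horizontal lines stay
  in the strip, so the \<open>x\<close>-derivative is two-sided even on the walls.\<close>

lemma C1_on_strip_partials: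
  fixes f :: "real \<times> real \<Rightarrow> 'a::real_normed_vector"
  assumes "C1_on strip f"
  shows "continuous_on strip f" "continuous_on strip (d_x f)" "continuous_on strip (d_y f)"
    and "-1 \<le> y \<Longrightarrow> y \<le> 1 \<Longrightarrow> ((\<lambda>\<xi>. f (\<xi>, y)) has_vector_derivative d_x f (x, y)) (at x)"
    and "-1 \<le> y \<Longrightarrow> y \<le> 1 \<Longrightarrow> ((\<lambda>\<eta>. f (x, \<eta>)) has_vector_derivative d_y f (x, y)) (at y within {-1..1})"
proof -
  obtain f' where f': "\<And>z. z \<in> strip \<Longrightarrow> (f has_derivative blinfun_apply (f' z)) (at z within strip)"
    and cont: "continuous_on strip f'"
    using assms unfolding C1_on_def by blast
  show "continuous_on strip f"
    by (rule has_derivative_continuous_on[OF f'])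
  have x: "((\<lambda>\<xi>. f (\<xi>, y)) has_vector_derivative f' (x, y) (1, 0)) (at x)" if "-1 \<le> y" "y \<le> 1" for x y
  proof -
    have emb: "((\<lambda>\<xi>. (\<xi>, y)) has_derivative (\<lambda>h. (h, 0))) (at x)"
      by (intro has_derivative_Pair has_derivative_ident has_derivative_const)
    have "((\<lambda>\<xi>. f (\<xi>, y)) has_derivative (\<lambda>h. f' (x, y) (h, 0))) (at x)"
      by (rule has_derivative_in_compose2[of strip f "\<lambda>z. blinfun_apply (f' z)" "\<lambda>\<xi>. (\<xi>, y)" UNIV, OF f' _ _ emb])
         (use that in auto)
    moreover have "f' (x, y) (h, 0) = h *\<^sub>R f' (x, y) (1, 0)" for h
      using blinfun.scaleR_right[of "f' (x, y)" h "(1, 0)"] by simp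
    then have "(\<lambda>h. f' (x, y) (h, 0)) = (\<lambda>h. h *\<^sub>R f' (x, y) (1, 0))"
      by (rule ext)
    ultimately show ?thesis
      unfolding has_vector_derivative_def by (rule has_derivative_eq_rhs)
  qed
  have y: "((\<lambda>\<eta>. f (x, \<eta>)) has_vector_derivative f' (x, y) (0, 1)) (at y within {-1..1})"
    if "-1 \<le> y" "y \<le> 1" for x y
  proof -
    have emb: "((\<lambda>\<eta>. (x, \<eta>)) has_derivative (\<lambda>h. (0, h))) (at y within {-1..1})"
      by (intro has_derivative_Pair has_derivative_ident has_derivative_const)
    have "((\<lambda>\<eta>. f (x, \<eta>)) has_derivative (\<lambda>h. f' (x, y) (0, h))) (at y within {-1..1})"
      by (rule has_derivative_in_compose2[of strip f "\<lambda>z. blinfun_apply (f' z)" "\<lambda>\<eta>. (x, \<eta>)" "{-1..1}", OF f' _ _ emb])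
         (use that in auto)
    moreover have "f' (x, y) (0, h) = h *\<^sub>R f' (x, y) (0, 1)" for h
      using blinfun.scaleR_right[of "f' (x, y)" h "(0, 1)"] by simp
    then have "(\<lambda>h. f' (x, y) (0, h)) = (\<lambda>h. h *\<^sub>R f' (x, y) (0, 1))"
      by (rule ext)
    ultimately show ?thesis
      unfolding has_vector_derivative_def by (rule has_derivative_eq_rhs)
  qed
  have dx: "d_x f (x, y) = f' (x, y) (1, 0)" if "-1 \<le> y" "y \<le> 1" for x y
    using x[OF that] by (simp add: d_x_def vector_derivative_at)
  have dy: "d_y f (x, y) = f' (x, y) (0, 1)" if "-1 \<le> y" "y \<le> 1" for x y
    using y[OF that] that
    by (auto simp: d_y_def intro!: vector_derivative_within_cbox[of "-1" 1, simplified cbox_interval])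
  show "continuous_on strip (d_x f)"
    by (rule continuous_on_eq[of _ "\<lambda>z. f' z (1, 0)"]) (auto intro!: continuous_intros cont simp: dx)
  show "continuous_on strip (d_y f)"
    by (rule continuous_on_eq[of _ "\<lambda>z. f' z (0, 1)"]) (auto intro!: continuous_intros cont simp: dy)
  show "((\<lambda>\<xi>. f (\<xi>, y)) has_vector_derivative d_x f (x, y)) (at x)" if "-1 \<le> y" "y \<le> 1" for x y
    using x dx that by simp
  show "((\<lambda>\<eta>. f (x, \<eta>)) has_vector_derivative d_y f (x, y)) (at y within {-1..1})" if "-1 \<le> y" "y \<le> 1" for x y
    using y dy that by simp
qed

lemma C1_on_has_strip_partials:
  assumes "C1_on strip f" "bounded_linear L"
  shows "has_strip_partials (\<lambda>z. L (f z)) (\<lambda>z. L (d_x f z)) (\<lambda>z. L (d_y f z))"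
  unfolding has_strip_partials_def has_real_derivative_iff_has_vector_derivative
  by (intro conjI allI ballI bounded_linear.continuous_on[OF assms(2)]
      bounded_linear.has_vector_derivative[OF assms(2)] C1_on_strip_partials[OF assms(1)]) auto

text \<open>Divergence and vorticity differentiate components, while the momentum equation
  differentiates the vector field; this reconciles the two.\<close>

lemma C1_on_component_partials:
  fixes L :: "'a::real_normed_vector \<Rightarrow> real"
  assumes "C1_on strip f" "bounded_linear L" and "z \<in> strip"
  shows "d_x (\<lambda>w. L (f w)) z = L (d_x f z)" "d_y (\<lambda>w. L (f w)) z = L (d_y f z)"
proof -
  obtain x y where z: "z = (x, y)" by (cases z)
  have y: "-1 \<le> y" "y \<le> 1" using assms(3) by (auto simp: z)
  show "d_x (\<lambda>w. L (f w)) z = L (d_x f z)"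
    using bounded_linear.has_vector_derivative[OF assms(2) C1_on_strip_partials(4)[OF assms(1) y]]
    by (simp add: z d_x_def[of "\<lambda>w. L (f w)"] vector_derivative_at)
  show "d_y (\<lambda>w. L (f w)) z = L (d_y f z)"
    using bounded_linear.has_vector_derivative[OF assms(2) C1_on_strip_partials(5)[OF assms(1) y]] y
    by (auto simp: z d_y_def[of "\<lambda>w. L (f w)"]
        intro!: vector_derivative_within_cbox[of "-1" 1, simplified cbox_interval])
qed

lemma C1_on_time_slice:
  fixes g :: "real \<times> (real \<times> real) \<Rightarrow> 'b::real_normed_vector"
  assumes "C1_on (UNIV \<times> strip) g"
  shows "C1_on strip (\<lambda>z. g (t, z))"
proof -
  obtain g' where g': "\<And>z. z \<in> UNIV \<times> strip \<Longrightarrow> (g has_derivative blinfun_apply (g' z)) (at z within UNIV \<times> strip)"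
    and cont: "continuous_on (UNIV \<times> strip) g'"
    using assms unfolding C1_on_def by blast
  define J :: "(real \<times> real) \<Rightarrow>\<^sub>L (real \<times> (real \<times> real))" where "J = Blinfun (\<lambda>z. (0, z))"
  have bl: "bounded_linear (\<lambda>z :: real \<times> real. (0 :: real, z))"
    by (intro bounded_linear_Pair bounded_linear_zero bounded_linear_ident)
  have J: "blinfun_apply J = (\<lambda>z. (0, z))"
    unfolding J_def by (rule bounded_linear_Blinfun_apply[OF bl])
  show ?thesis
    unfolding C1_on_def
  proof (intro exI[of _ "\<lambda>z. g' (t, z) o\<^sub>L J"] conjI ballI)
    fix z assume z: "z \<in> strip"
    have emb: "((\<lambda>z. (t, z)) has_derivative (\<lambda>h. (0, h))) (at z within strip)"
      by (intro has_derivative_Pair has_derivative_ident has_derivative_const)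
    have "((\<lambda>z. g (t, z)) has_derivative (\<lambda>h. g' (t, z) (0, h))) (at z within strip)"
      by (rule has_derivative_in_compose2[of "UNIV \<times> strip" g "\<lambda>z. blinfun_apply (g' z)" "\<lambda>z. (t, z)" strip, OF g' _ _ emb])
         (use z in auto)
    then show "((\<lambda>z. g (t, z)) has_derivative blinfun_apply (g' (t, z) o\<^sub>L J)) (at z within strip)"
      by (simp add: J blinfun_compose.rep_eq o_def)
  next
    show "continuous_on strip (\<lambda>z. g' (t, z) o\<^sub>L J)"
      by (intro continuous_intros continuous_on_compose2[OF cont]) auto
  qed
qed

text \<open>Everything is read off at time 0, where the wave equals \<open>U\<close> and the chain
  rule turns the time derivative into \<open>- c *\<^sub>R d_x U z\<close>.\<close>

lemma traveling_wave_profile: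
  assumes "traveling_wave_solution c U"
  obtains P where "C1_on strip U" "C1_on strip P" "x_periodic P"
    and "\<And>z. z \<in> strip \<Longrightarrow> - c *\<^sub>R d_x U z + advection U U z + grad P z = 0"
    and "\<And>z. z \<in> strip \<Longrightarrow> divergence U z = 0"
    and "\<And>x. snd (U (x, 1)) = 0" "\<And>x. snd (U (x, -1)) = 0"
proof -
  define u where "u = (\<lambda>t (x, y). U (x - c * t, y))"
  obtain p where sol: "euler_solution u p"
    using assms unfolding traveling_wave_solution_def u_def by blast
  have u0: "u 0 = U" by (auto simp: u_def)
  have "C1_on (UNIV \<times> strip) (\<lambda>(t, z). u t z)"
    using sol unfolding euler_solution_def by blast
  from C1_on_time_slice[OF this, of 0] have U: "C1_on strip U"
    by (simp add: u0)
  have time: "vector_derivative (\<lambda>\<tau>. u \<tau> z) (at 0) = - c *\<^sub>R d_x U z" if "z \<in> strip" for z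
  proof -
    obtain x y where z: "z = (x, y)" by (cases z)
    have y: "-1 \<le> y" "y \<le> 1" using that by (auto simp: z)
    have "((\<lambda>\<tau>. x - c * \<tau>) has_vector_derivative - c) (at 0)"
      by (auto intro!: derivative_eq_intros simp flip: has_real_derivative_iff_has_vector_derivative)
    from vector_diff_chain_at[OF this, of "\<lambda>\<xi>. U (\<xi>, y)" "d_x U (x, y)"]
    have "((\<lambda>\<tau>. U (x - c * \<tau>, y)) has_vector_derivative - c *\<^sub>R d_x U (x, y)) (at 0)"
      using C1_on_strip_partials(4)[OF U y, of x] by (simp add: o_def)
    then show ?thesis by (simp add: u_def z vector_derivative_at)
  qed
  show thesis
  proof (rule that[of "p 0"])
    show "- c *\<^sub>R d_x U z + advection U U z + grad (p 0) z = 0" if "z \<in> strip" for z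
      using sol that time[OF that] u0 unfolding euler_solution_def by metis
    show "divergence U z = 0" if "z \<in> strip" for z
      using sol that u0 unfolding euler_solution_def by metis
    show "snd (U (x, 1)) = 0" "snd (U (x, -1)) = 0" for x
      using sol u0 unfolding euler_solution_def by metis+
    show "C1_on strip (p 0)" "x_periodic (p 0)"
      using sol unfolding euler_solution_def by blast+
  qed (fact U)
qed

theorem theorem3:
  fixes s :: real
  assumes "s > 5"
  shows "\<exists>\<epsilon>\<^sub>0 > 0. \<forall>(c :: real) (U :: real \<times> real \<Rightarrow> real \<times> real) (\<Psi> :: real \<times> real \<Rightarrow> real)
           (\<Omega> :: real \<times> real \<Rightarrow> real).
           traveling_wave_solution c U \<longrightarrow>
           (\<forall>z\<in>strip. \<Omega> z = vorticity U z) \<longrightarrow>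
           x_periodic \<Psi> \<longrightarrow> C1_on strip \<Psi> \<longrightarrow>
           (\<forall>z\<in>strip. U z = perp_grad \<Psi> z) \<longrightarrow>
           (\<forall>z\<in>strip. laplacian \<Psi> z = \<Omega> z) \<longrightarrow>
           sobolev_norm s (\<lambda>(x, y). \<Omega> (x, y) + 2 * y) \<le> ennreal \<epsilon>\<^sub>0 \<longrightarrow>
           shear_flow U"
proof -
  obtain \<epsilon> where \<epsilon>: "\<epsilon> > 0" and reg: "\<And>f. sobolev_norm s f \<le> ennreal \<epsilon> \<Longrightarrow>
      \<exists>F. (\<forall>z\<in>strip. f z = fourier_partial F 0 0 z) \<and>
      (\<forall>a b. a + b \<le> 2 \<longrightarrow>
        has_strip_partials (fourier_partial F a b) (fourier_partial F (Suc a) b) (fourier_partial F a (Suc b))) \<and>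
      (\<forall>z. \<bar>fourier_partial F 0 1 z\<bar> < 2)"
    using small_sobolev_norm_fourier_partials[of s] assms by (metis less_imp_le)
  have "shear_flow U" if tw: "traveling_wave_solution c U"
    and vort: "\<And>z. z \<in> strip \<Longrightarrow> \<Omega> z = vorticity U z"
    and small: "sobolev_norm s (\<lambda>(x, y). \<Omega> (x, y) + 2 * y) \<le> ennreal \<epsilon>" for c U \<Omega>
  proof -
    obtain P where U: "C1_on strip U" and P: "C1_on strip P" "x_periodic P"
      and mom: "\<And>z. z \<in> strip \<Longrightarrow> - c *\<^sub>R d_x U z + advection U U z + grad P z = 0"
      and div: "\<And>z. z \<in> strip \<Longrightarrow> divergence U z = 0"
      and wall: "\<And>x. snd (U (x, 1)) = 0" "\<And>x. snd (U (x, -1)) = 0"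
      using traveling_wave_profile[OF tw] by metis
    obtain F where F: "\<And>z. z \<in> strip \<Longrightarrow> (\<lambda>(x, y). \<Omega> (x, y) + 2 * y) z = fourier_partial F 0 0 z"
      and part: "\<And>a b. a + b \<le> 2 \<Longrightarrow>
        has_strip_partials (fourier_partial F a b) (fourier_partial F (Suc a) b) (fourier_partial F a (Suc b))"
      and gy: "\<And>z. \<bar>fourier_partial F 0 1 z\<bar> < 2"
      using reg[OF small] by blast
    \<comment> \<open>The vorticity on the strip, recovered from its smooth Fourier representation
      by adding back the Poiseuille part.\<close>
    define Om where "Om z = fourier_partial F 0 0 z + (-2) * snd z" for z
    have Om: "has_strip_partials Om (fourier_partial F 1 0) (\<lambda>z. fourier_partial F 0 1 z + (-2))"
    proof -
      have "has_strip_partials (\<lambda>z. fourier_partial F 0 0 z + (-2) * snd z)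
          (\<lambda>z. fourier_partial F (Suc 0) 0 z + (0 * snd z + (-2) * 0))
          (\<lambda>z. fourier_partial F 0 (Suc 0) z + (0 * snd z + (-2) * 1))"
        by (intro has_strip_partials_add has_strip_partials_mult has_strip_partials_const
            has_strip_partials_snd part) simp
      then show ?thesis unfolding Om_def by simp
    qed
    have Oy: "has_strip_partials (\<lambda>z. fourier_partial F 0 1 z + (-2)) (fourier_partial F 1 1) (fourier_partial F 0 2)"
      using has_strip_partials_add[OF part[of 0 1] has_strip_partials_const[of "-2"]]
      by (simp add: numeral_2_eq_2)
    have Ox: "has_strip_partials (fourier_partial F 1 0) (fourier_partial F 2 0) (fourier_partial F 1 1)"
      using part[of 1 0] by (simp add: numeral_2_eq_2)
    have C1: "C1_strip (fourier_partial F a b)" if "a + b \<le> 2" for a b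
      using part[OF that] unfolding C1_strip_def by blast
    note fst_U = C1_on_component_partials[OF U bounded_linear_fst]
    note snd_U = C1_on_component_partials[OF U bounded_linear_snd]
    \<comment> \<open>The Galilean shift absorbs the term \<open>- c *\<^sub>R d_x U z\<close> into
      the advection, leaving the steady Euler equations with the same derivatives of the
      velocity.\<close>
    define W1 where "W1 z = fst (U z) + (-c)" for z
    have "has_strip_partials W1 (\<lambda>z. fst (d_x U z) + 0) (\<lambda>z. fst (d_y U z) + 0)"
      unfolding W1_def
      by (intro has_strip_partials_add has_strip_partials_const C1_on_has_strip_partials[OF U] bounded_linear_fst)
    then have W1: "has_strip_partials W1 (\<lambda>z. fst (d_x U z)) (\<lambda>z. fst (d_y U z))"
      by simp
    have W2: "has_strip_partials (\<lambda>z. snd (U z)) (\<lambda>z. snd (d_x U z)) (\<lambda>z. snd (d_y U z))"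
      by (intro C1_on_has_strip_partials[OF U] bounded_linear_snd)
    have P': "has_strip_partials P (d_x P) (d_y P)"
      using C1_on_has_strip_partials[OF P(1) bounded_linear_ident] by simp
    have div': "fst (d_x U z) + snd (d_y U z) = 0" if "z \<in> strip" for z
      using div[OF that] fst_U[OF that] snd_U[OF that] by (simp add: divergence_def)
    have mom1: "W1 z * fst (d_x U z) + snd (U z) * fst (d_y U z) + d_x P z = 0"
      and mom2: "W1 z * snd (d_x U z) + snd (U z) * snd (d_y U z) + d_y P z = 0" if "z \<in> strip" for z
      using arg_cong[OF mom[OF that], of fst] arg_cong[OF mom[OF that], of snd]
      by (simp_all add: advection_def grad_def W1_def algebra_simps)
    have vort': "Om z = snd (d_x U z) - fst (d_y U z)" if "z \<in> strip" for z
    proof -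
      have "Om z = \<Omega> z" using F[OF that] by (simp add: Om_def split_beta)
      then show ?thesis
        using vort[OF that] fst_U[OF that] snd_U[OF that] by (simp add: vorticity_def)
    qed
    have W2_0: "snd (U z) = 0" if "z \<in> strip" for z
    proof (rule steady_euler_monotone_vorticity_shear[OF W1 W2 P' Om Ox Oy _ _ _ _ mom1 mom2 div' vort' wall,
          where p = "2 * pi"])
      show "P (x + 2 * pi, y) = P (x, y)" if "(x, y) \<in> strip" for x y
        using P(2) that unfolding x_periodic_def by blast
      show "Om (x + 2 * pi, y) = Om (x, y)" for x y
        by (simp add: Om_def fourier_partial_periodic)
      \<comment> \<open>The perturbation changes the \<open>y\<close>-derivative -2 of the
        Poiseuille vorticity by less than 2.\<close>
      show "fourier_partial F 0 1 z + (-2) \<noteq> 0" for z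
        using gy[of z] by auto
    qed (use that C1 in auto)
    \<comment> \<open>With zero vertical velocity, incompressibility makes the horizontal velocity
      independent of \<open>x\<close>. The radius 1 is arbitrary.\<close>
    have "snd (d_y U z) = 0" if "z \<in> strip" for z
      using has_strip_partials_locally_zero(2)[OF W2, of z 1 z] W2_0 that by simp
    then have dx0: "fst (d_x U z) = 0" if "z \<in> strip" for z
      using div'[OF that] that by simp
    have profile: "U (x, y) = (fst (U (0, y)), 0)" if "-1 \<le> y" "y \<le> 1" for x y
      using has_strip_partialsD(4)[OF W1 that] dx0 that
        DERIV_isconst_all[of "\<lambda>\<xi>. W1 (\<xi>, y)" x 0] W2_0[of "(x, y)"]
      by (intro prod_eqI) (simp_all add: W1_def)
    show "shear_flow U"
      unfolding shear_flow_def
      by (intro exI[of _ "\<lambda>y. fst (U (0, y))"] ballI case_prodI2 profile) auto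
  qed
  then show ?thesis
    using \<epsilon> by (intro exI[of _ \<epsilon>]) blast
qed

end
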